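(* Let $G$ be a finite group. Then the co-prime graph $\Gamma(G)$ is a split graph if and only if $G$ is a nilpotent group of order $p^n$ or $2p^n$ for some prime $p$ and some integer $n\ge 0$.
   Context: For a finite group $G$, the co-prime graph $\Gamma(G)$ is the simple undirected graph with vertex set $G$ (including the identity) in which two distinct vertices $x,y$ are adjacent if and only if $\gcd(o(x),o(y))=1$, where $o(g)$ denotes the order of $g$. A split graph is a graph whose vertices can be partitioned into an independent set and a clique (either part may be empty). *)

theory Defs
  imports "HOL-Algebra.Algebra" "HOL-Library.Ramsey"
begin

text \<open>
  A simple undirected graph is a pair \<open>(V, E)\<close> of a vertex set and a set of two-element
  subsets of it; \<^const>\<open>clique\<close> and \<^const>\<open>indep\<close> use the same convention for edges.
\<close>

type_synonym 'a ugraph = "'a set \<times> 'a set set"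

definition coprime_graph :: "('a, 'b) monoid_scheme \<Rightarrow> 'a ugraph" where
  "coprime_graph G =
     (carrier G,
      {{x, y} | x y. x \<in> carrier G \<and> y \<in> carrier G \<and> x \<noteq> y
                     \<and> gcd (group.ord G x) (group.ord G y) = 1})"

lemma coprime_graph_simple:
  "snd (coprime_graph G) \<subseteq> [fst (coprime_graph G)]\<^bsup>2\<^esup>"
  by (auto simp: coprime_graph_def nsets_def)

lemma coprime_graph_adjacent_iff:
  assumes "x \<noteq> y"
  shows "{x, y} \<in> snd (coprime_graph G) \<longleftrightarrow>
           x \<in> carrier G \<and> y \<in> carrier G \<and> gcd (group.ord G x) (group.ord G y) = 1"
  using assms by (auto simp: coprime_graph_def doubleton_eq_iff gcd.commute)

definition split_graph :: "'a ugraph \<Rightarrow> bool" where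
  "split_graph \<Gamma> \<longleftrightarrow>
     (\<exists>I K. I \<union> K = fst \<Gamma> \<and> I \<inter> K = {} \<and> indep I (snd \<Gamma>) \<and> clique K (snd \<Gamma>))"

text \<open>
  The subgroup \<open>[H, K]\<close> generated by all commutators \<open>h k h\<^sup>-\<^sup>1 k\<^sup>-\<^sup>1\<close>. It generalises
  \<^const>\<open>derived\<close>, which is the case \<open>H = K\<close>.
\<close>

definition commutator_subgroup :: "('a, 'b) monoid_scheme \<Rightarrow> 'a set \<Rightarrow> 'a set \<Rightarrow> 'a set" where
  "commutator_subgroup G H K =
     generate G (\<Union>h\<in>H. \<Union>k\<in>K. {h \<otimes>\<^bsub>G\<^esub> k \<otimes>\<^bsub>G\<^esub> inv\<^bsub>G\<^esub> h \<otimes>\<^bsub>G\<^esub> inv\<^bsub>G\<^esub> k})"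

lemma commutator_subgroup_same: "commutator_subgroup G H H = derived G H"
  by (simp add: commutator_subgroup_def derived_def)

primrec lower_central_series :: "('a, 'b) monoid_scheme \<Rightarrow> nat \<Rightarrow> 'a set" where
  "lower_central_series G 0 = carrier G"
| "lower_central_series G (Suc n) =
     commutator_subgroup G (lower_central_series G n) (carrier G)"

definition nilpotent_group :: "('a, 'b) monoid_scheme \<Rightarrow> bool" where
  "nilpotent_group G \<longleftrightarrow> group G \<and> (\<exists>n. lower_central_series G n = {\<one>\<^bsub>G\<^esub>})"

end

theory Submission
  imports Defs
begin

text \<open>
  In a split graph, of any two distinct non-adjacent vertices at least one lies in the independent
  part. So two non-adjacent pairs cannot be completely joined to each other: a split graph has no
  induced 4-cycle. If two powers of distinct primes, both at least 3, divided the group order, the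
  subgroups of these orders would supply two such pairs of non-identity elements
  (\<open>coprime_graph_not_split\<close>, \<open>two_elements_of_p_power_order\<close>). By arithmetic
  (\<open>two_large_prime_powers_dvd\<close>) the order is therefore \<open>p\<^sup>n\<close> or \<open>2p\<^sup>n\<close>. A
  group of order \<open>p\<^sup>n\<close> is nilpotent because non-trivial \<open>p\<close>-groups have non-trivial centres. When
  the order is \<open>2p\<^sup>n\<close>
  with \<open>p\<close> odd and \<open>n \<ge> 1\<close>, two involutions would again complete a 4-cycle with two elements of
  \<open>p\<close>-power order. Hence there is a unique involution; it equals all its conjugates, so it is
  central, and a group of order \<open>2p\<^sup>n\<close> with a central involution is nilpotent.

  Conversely, a \<open>p\<close>-group has all non-identity orders divisible by \<open>p\<close>, so splitting off the
  identity works. In a nilpotent group, elements of coprime order commute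
  (\<open>nilpotent_coprime_commute\<close>). For order \<open>2p\<^sup>n\<close> with \<open>p\<close> odd this forces a unique involution \<open>z\<close>
  (\<open>nilpotent_unique_involution\<close>), every element other than \<open>1\<close> and \<open>z\<close> has order divisible by \<open>p\<close>,
  and the clique \<open>{1, z}\<close> can be split off.

  Both links to nilpotency use one tool: for a normal subgroup \<open>N\<close>, the preimage \<open>central_mod N\<close> of
  the centre of \<open>G/N\<close>. A finite group is nilpotent as soon as \<open>central_mod N\<close> is strictly larger
  than \<open>N\<close> for every proper normal \<open>N\<close> (\<open>nilpotent_if_central_mod_grows\<close>). Phrasing this inside
  one group \<open>G\<close> means that no induction has to pass to quotient groups, whose elements have a
  different type.
\<close>

section \<open>Centres of p-groups\<close>

text \<open>
  Orbit sizes are powers of \<open>p\<close>, and they add up to a multiple of \<open>p\<close>. One orbit of size 1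
  therefore cannot be the only one.
\<close>
lemma (in group_action) p_group_second_fixed_point:
  assumes "Factorial_Ring.prime (p::nat)" "order G = p ^ n" "finite E" "p dvd card E"
    and "x \<in> E" "orbit G \<phi> x = {x}"
  obtains y where "y \<in> E" "y \<noteq> x" "orbit G \<phi> y = {y}"
proof -
  have part: "\<Union>(orbits G E \<phi>) = E"
    by (rule orbits_coverture)
  have disj: "disjoint (orbits G E \<phi>)"
    using disjoint_union unfolding disjoint_def by blast
  have fin: "finite orb" if "orb \<in> orbits G E \<phi>" for orb
    using finite_subset[OF Union_upper[OF that]] part assms(3) by simp
  have fins: "finite (orbits G E \<phi>)"
    by (rule finite_UnionD) (simp add: part assms(3))
  have x_orb: "{x} \<in> orbits G E \<phi>"
    using assms(5,6) unfolding orbits_def by force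
  have "card E = (\<Sum>orb\<in>orbits G E \<phi>. card orb)"
    using card_Union_disjoint[OF disj fin] part by simp
  also have "\<dots> = 1 + (\<Sum>orb\<in>orbits G E \<phi> - {{x}}. card orb)"
    using sum.remove[OF fins x_orb, of card] by simp
  finally have card_E: "card E = 1 + (\<Sum>orb\<in>orbits G E \<phi> - {{x}}. card orb)" .
  have "\<not> p dvd (\<Sum>orb\<in>orbits G E \<phi> - {{x}}. card orb)"
  proof
    assume "p dvd (\<Sum>orb\<in>orbits G E \<phi> - {{x}}. card orb)"
    then have "p dvd 1"
      using assms(4) by (simp only: card_E dvd_add_left_iff)
    then show False
      using assms(1) not_prime_unit by blast
  qed
  then obtain orb where orb: "orb \<in> orbits G E \<phi>" "orb \<noteq> {x}" "\<not> p dvd card orb"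
    using dvd_sum[of "orbits G E \<phi> - {{x}}" p card] by blast
  then obtain y where y: "y \<in> E" "orb = orbit G \<phi> y"
    unfolding orbits_def by blast
  have "card orb dvd p ^ n"
    using orbit_stabilizer_theorem[OF y(1)] assms(2) y(2) by (metis dvd_triv_left)
  then obtain i where i: "card orb = p ^ i"
    using divides_primepow_nat[OF assms(1)] by blast
  then have "i = 0"
    using orb(3) by (cases i) auto
  then have "card orb = 1"
    using i by simp
  then have "orb = {y}"
    using y orbit_refl[OF y(1)] by (metis card_1_singletonE singletonD)
  then show thesis
    using that y orb(2) by blast
qed

context group
begin

lemma inv_cancel_middle:
  assumes "x \<in> carrier G" "y \<in> carrier G"
  shows "inv x \<otimes> (x \<otimes> y) = y"
  using assms by (simp flip: m_assoc)

lemma commute_inv: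
  assumes "x \<in> carrier G" "y \<in> carrier G" "x \<otimes> y = y \<otimes> x"
  shows "inv x \<otimes> y = y \<otimes> inv x"
proof -
  have "inv x \<otimes> y = inv x \<otimes> (y \<otimes> x) \<otimes> inv x"
    using assms(1,2) by (simp add: m_assoc)
  also have "\<dots> = inv x \<otimes> (x \<otimes> y) \<otimes> inv x"
    using assms(3) by simp
  also have "\<dots> = y \<otimes> inv x"
    using assms(1,2) by (simp add: inv_cancel_middle)
  finally show ?thesis .
qed

lemma ord_in_subgroup:
  assumes "subgroup H G" "x \<in> H"
  shows "group.ord (G\<lparr>carrier := H\<rparr>) x = ord x"
proof -
  interpret H: group "G\<lparr>carrier := H\<rparr>"
    by (rule subgroup.subgroup_is_group[OF assms(1) is_group])
  have "x \<in> carrier G"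
    using assms by (rule subgroup.mem_carrier)
  then show ?thesis
    using assms(2) by (simp add: H.ord_unique pow_eq_id flip: nat_pow_consistent)
qed

text \<open>
  The fixed points of conjugation are the central elements, and the identity is one of them.
\<close>
lemma p_group_central_element:
  assumes "finite (carrier G)" "Factorial_Ring.prime (p::nat)" "order G = p ^ n" "order G \<noteq> 1"
  obtains z where "z \<in> carrier G" "z \<noteq> \<one>" "\<And>g. g \<in> carrier G \<Longrightarrow> g \<otimes> z = z \<otimes> g"
proof -
  let ?conj = "\<lambda>g. \<lambda>h \<in> carrier G. g \<otimes> h \<otimes> inv g"
  interpret conj: group_action G "carrier G" ?conj
    by (rule action_by_conjugation)
  have "p dvd card (carrier G)"
    using assms by (cases n) (auto simp: order_def)
  moreover have "orbit G ?conj \<one> = {\<one>}"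
    unfolding orbit_def by (auto intro!: exI[of _ \<one>])
  ultimately obtain z where z: "z \<in> carrier G" "z \<noteq> \<one>" "orbit G ?conj z = {z}"
    using conj.p_group_second_fixed_point[OF assms(2,3,1)] by blast
  have "g \<otimes> z = z \<otimes> g" if g: "g \<in> carrier G" for g
  proof -
    have "?conj g z \<in> orbit G ?conj z"
      using g unfolding orbit_def by blast
    then show ?thesis
      using z g by (simp add: inv_solve_right')
  qed
  then show thesis
    using that z by blast
qed

section \<open>The preimage of the centre of a quotient\<close>

text \<open>
  The preimage in \<open>G\<close> of the centre of \<open>G/N\<close>, written with commutators so that it can be compared
  directly with the lower central series.
\<close>
definition central_mod :: "'a set \<Rightarrow> 'a set" where
  "central_mod N = {x \<in> carrier G. \<forall>g\<in>carrier G. x \<otimes> g \<otimes> inv x \<otimes> inv g \<in> N}"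

lemma central_mod_iff_coset_central:
  assumes "N \<lhd> G" "x \<in> carrier G"
  shows "x \<in> central_mod N \<longleftrightarrow>
    (\<forall>Y\<in>carrier (G Mod N). (N #> x) \<otimes>\<^bsub>G Mod N\<^esub> Y = Y \<otimes>\<^bsub>G Mod N\<^esub> (N #> x))"
proof -
  interpret N: normal N G by fact
  have sub: "subgroup N G" by (rule N.subgroup_axioms)
  have "N #> (x \<otimes> g) = N #> (g \<otimes> x) \<longleftrightarrow> x \<otimes> g \<otimes> inv x \<otimes> inv g \<in> N"
    if g: "g \<in> carrier G" for g
  proof -
    have "N #> (x \<otimes> g) = N #> (g \<otimes> x) \<longleftrightarrow> x \<otimes> g \<in> N #> (g \<otimes> x)"
      using assms(2) g repr_independence[OF _ _ sub, of "x \<otimes> g" "g \<otimes> x"]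
        rcos_self[OF _ sub, of "x \<otimes> g"] by auto
    also have "\<dots> \<longleftrightarrow> x \<otimes> g \<otimes> inv (g \<otimes> x) \<in> N"
      using assms(2) g by (intro N.rcos_module is_group) auto
    finally show ?thesis
      using assms(2) g by (simp add: inv_mult_group m_assoc)
  qed
  then show ?thesis
    using assms(2) by (auto simp: central_mod_def carrier_FactGroup N.rcos_sum)
qed

lemma central_mod_normal:
  assumes "N \<lhd> G"
  shows "central_mod N \<lhd> G"
proof -
  interpret N: normal N G by fact
  interpret Q: group "G Mod N" by (rule N.factorgroup_is_group)
  let ?h = "\<lambda>x. N #> x"
  have hom: "?h (x \<otimes> y) = ?h x \<otimes>\<^bsub>G Mod N\<^esub> ?h y" if "x \<in> carrier G" "y \<in> carrier G" for x y
    using that by (simp add: N.rcos_sum)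
  have mem: "?h x \<in> carrier (G Mod N)" if "x \<in> carrier G" for x
    using that by (auto simp: carrier_FactGroup)
  interpret h: group_hom G "G Mod N" ?h
    using N.r_coset_hom_Mod by unfold_locales
  note iff = central_mod_iff_coset_central[OF assms]
  show ?thesis
  proof (intro normal_invI subgroupI)
    show "central_mod N \<subseteq> carrier G"
      by (auto simp: central_mod_def)
    have "\<one> \<in> central_mod N"
      by (auto simp: central_mod_def)
    then show "central_mod N \<noteq> {}"
      by auto
  next
    fix x assume x: "x \<in> central_mod N"
    then have xG: "x \<in> carrier G" by (simp add: central_mod_def)
    show "inv x \<in> central_mod N"
      using x xG mem[of x] Q.commute_inv[of "?h x"]
      by (simp add: iff del: mult_FactGroup)
  next
    fix x y assume x: "x \<in> central_mod N" and y: "y \<in> central_mod N"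
    then have xG: "x \<in> carrier G" and yG: "y \<in> carrier G" by (simp_all add: central_mod_def)
    show "x \<otimes> y \<in> central_mod N"
      unfolding iff[OF m_closed[OF xG yG]] hom[OF xG yG]
    proof
      fix Y assume Y: "Y \<in> carrier (G Mod N)"
      note [simp] = mem[OF xG] mem[OF yG] Y
      have "?h x \<otimes>\<^bsub>G Mod N\<^esub> ?h y \<otimes>\<^bsub>G Mod N\<^esub> Y = ?h x \<otimes>\<^bsub>G Mod N\<^esub> (Y \<otimes>\<^bsub>G Mod N\<^esub> ?h y)"
        using y yG by (simp add: iff Q.m_assoc del: mult_FactGroup)
      also have "\<dots> = (?h x \<otimes>\<^bsub>G Mod N\<^esub> Y) \<otimes>\<^bsub>G Mod N\<^esub> ?h y"
        by (simp add: Q.m_assoc del: mult_FactGroup)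
      also have "?h x \<otimes>\<^bsub>G Mod N\<^esub> Y = Y \<otimes>\<^bsub>G Mod N\<^esub> ?h x"
        using x xG Y iff by blast
      also have "\<dots> \<otimes>\<^bsub>G Mod N\<^esub> ?h y = Y \<otimes>\<^bsub>G Mod N\<^esub> (?h x \<otimes>\<^bsub>G Mod N\<^esub> ?h y)"
        by (simp add: Q.m_assoc del: mult_FactGroup)
      finally show "?h x \<otimes>\<^bsub>G Mod N\<^esub> ?h y \<otimes>\<^bsub>G Mod N\<^esub> Y
          = Y \<otimes>\<^bsub>G Mod N\<^esub> (?h x \<otimes>\<^bsub>G Mod N\<^esub> ?h y)" .
    qed
  next
    fix g x assume g: "g \<in> carrier G" and x: "x \<in> central_mod N"
    then have xG: "x \<in> carrier G" by (simp add: central_mod_def)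
    have "?h (g \<otimes> x \<otimes> inv g) = ?h x"
    proof -
      have "?h (g \<otimes> x \<otimes> inv g) = ?h g \<otimes>\<^bsub>G Mod N\<^esub> ?h x \<otimes>\<^bsub>G Mod N\<^esub> inv\<^bsub>G Mod N\<^esub> ?h g"
        using xG g by (simp add: hom del: mult_FactGroup)
      also have "\<dots> = ?h x \<otimes>\<^bsub>G Mod N\<^esub> ?h g \<otimes>\<^bsub>G Mod N\<^esub> inv\<^bsub>G Mod N\<^esub> ?h g"
        using x xG mem[OF g] by (simp add: iff del: mult_FactGroup)
      also have "\<dots> = ?h x"
        using mem[OF xG] mem[OF g] by (simp add: Q.m_assoc del: mult_FactGroup one_FactGroup)
      finally show ?thesis .
    qed
    then show "g \<otimes> x \<otimes> inv g \<in> central_mod N"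
      using x xG g by (simp add: iff del: mult_FactGroup)
  qed
qed

lemma subset_central_mod:
  assumes "N \<lhd> G"
  shows "N \<subseteq> central_mod N"
proof
  interpret N: normal N G by fact
  fix x assume x: "x \<in> N"
  then have xG: "x \<in> carrier G" by (rule N.mem_carrier)
  have "x \<otimes> (g \<otimes> inv x \<otimes> inv g) \<in> N" if "g \<in> carrier G" for g
    using that x N.inv_op_closed2 by blast
  then show "x \<in> central_mod N"
    using xG by (simp add: central_mod_def m_assoc)
qed

section \<open>Nilpotency of finite groups\<close>

text \<open>
  A conjugate of a commutator is the commutator of the conjugates.
\<close>
lemma lower_central_series_normal: "lower_central_series G n \<lhd> G"
proof (induction n)
  case 0
  show ?case by (simp add: normal_self)
next
  case (Suc n)
  interpret L: normal "lower_central_series G n" G by fact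
  show ?case
    unfolding lower_central_series.simps commutator_subgroup_def
  proof (rule normal_generateI)
    show "(\<Union>h\<in>lower_central_series G n. \<Union>k\<in>carrier G. {h \<otimes> k \<otimes> inv h \<otimes> inv k}) \<subseteq> carrier G"
      using L.mem_carrier by auto
  next
    fix c g
    assume c: "c \<in> (\<Union>h\<in>lower_central_series G n. \<Union>k\<in>carrier G. {h \<otimes> k \<otimes> inv h \<otimes> inv k})"
      and g: "g \<in> carrier G"
    then obtain h k where hk: "h \<in> lower_central_series G n" "k \<in> carrier G"
      and c_eq: "c = h \<otimes> k \<otimes> inv h \<otimes> inv k" by blast
    have h: "h \<in> carrier G" using hk L.mem_carrier by simp
    let ?c = "\<lambda>x. g \<otimes> x \<otimes> inv g"
    have "?c c = ?c h \<otimes> ?c k \<otimes> inv (?c h) \<otimes> inv (?c k)"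
      using g h hk(2) by (simp add: c_eq m_assoc inv_mult_group inv_cancel_middle)
    moreover have "?c h \<in> lower_central_series G n"
      using g hk(1) by (rule L.inv_op_closed2)
    moreover have "?c k \<in> carrier G"
      using g hk(2) by simp
    ultimately show "?c c \<in> (\<Union>h\<in>lower_central_series G n. \<Union>k\<in>carrier G. {h \<otimes> k \<otimes> inv h \<otimes> inv k})"
      by (intro UN_I) simp_all
  qed
qed

lemma commutator_in_lower_central_series:
  assumes "x \<in> lower_central_series G n" "y \<in> carrier G"
  shows "x \<otimes> y \<otimes> inv x \<otimes> inv y \<in> lower_central_series G (Suc n)"
  unfolding lower_central_series.simps commutator_subgroup_def
  by (rule generate.incl, rule UN_I[OF assms(1)], rule UN_I[OF assms(2)]) simp

lemma lower_central_series_subset_central_mod: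
  "lower_central_series G n \<subseteq> central_mod (lower_central_series G (Suc n))"
proof
  fix x assume x: "x \<in> lower_central_series G n"
  then have "x \<in> carrier G"
    by (rule subgroup.mem_carrier[OF normal_imp_subgroup[OF lower_central_series_normal]])
  then show "x \<in> central_mod (lower_central_series G (Suc n))"
    unfolding central_mod_def using commutator_in_lower_central_series[OF x] by blast
qed

text \<open>
  Every normal subgroup \<open>N\<close> contains a term of the lower central series, by induction from \<open>N = G\<close>
  downwards: if a term is contained in the larger group \<open>central_mod N\<close>, then its commutators with
  \<open>G\<close> lie in \<open>N\<close>, and so the next term does. The trivial subgroup is the case of interest.
\<close>
lemma nilpotent_if_central_mod_grows:
  assumes fin: "finite (carrier G)"
    and grows: "\<And>N. N \<lhd> G \<Longrightarrow> N \<noteq> carrier G \<Longrightarrow> central_mod N \<noteq> N"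
  shows "nilpotent_group G"
proof -
  have "\<exists>n. lower_central_series G n \<subseteq> N" if "N \<lhd> G" for N
    using that
  proof (induction "card (carrier G) - card N" arbitrary: N rule: less_induct)
    case less
    interpret N: normal N G by fact
    show ?case
    proof (cases "N = carrier G")
      case True
      then have "lower_central_series G 0 \<subseteq> N"
        by simp
      then show ?thesis ..
    next
      case False
      have Z: "central_mod N \<lhd> G"
        by (rule central_mod_normal[OF less.prems])
      interpret Z: normal "central_mod N" G by fact
      have "N \<subset> central_mod N"
        using grows[OF less.prems False] subset_central_mod[OF less.prems] by (simp add: psubset_eq)
      moreover have "finite (central_mod N)"
        by (rule finite_subset[OF Z.subset fin])
      ultimately have "card N < card (central_mod N)"
        by (rule psubset_card_mono[rotated])
      moreover have "card (central_mod N) \<le> card (carrier G)"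
        using card_mono[OF fin Z.subset] .
      ultimately have "card (carrier G) - card (central_mod N) < card (carrier G) - card N"
        by linarith
      then obtain n where "lower_central_series G n \<subseteq> central_mod N"
        using less.hyps[OF _ Z] by blast
      then have "x \<otimes> g \<otimes> inv x \<otimes> inv g \<in> N"
        if "x \<in> lower_central_series G n" "g \<in> carrier G" for x g
        using that unfolding central_mod_def by blast
      then have "lower_central_series G (Suc n) \<subseteq> N"
        unfolding lower_central_series.simps commutator_subgroup_def
        by (intro generate_subgroup_incl[OF _ N.subgroup_axioms] UN_least) simp
      then show ?thesis ..
    qed
  qed
  then obtain n where "lower_central_series G n \<subseteq> {\<one>}"
    using one_is_normal by metis
  then have "lower_central_series G n = {\<one>}"
    using subgroup.one_closed[OF normal_imp_subgroup[OF lower_central_series_normal[of n]]]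
    by (simp add: subset_singleton_iff) blast
  then show ?thesis
    unfolding nilpotent_group_def using is_group by (intro conjI exI)
qed

lemma p_quotient_central_mod_grows:
  assumes fin: "finite (carrier G)" and N: "N \<lhd> G" "N \<noteq> carrier G"
    and p: "Factorial_Ring.prime (p::nat)" "card (rcosets N) dvd p ^ n"
  shows "central_mod N \<noteq> N"
proof -
  interpret N: normal N G by fact
  interpret Q: group "G Mod N" by (rule N.factorgroup_is_group)
  have oQ: "order (G Mod N) = card (rcosets N)"
    by (simp add: order_def FactGroup_def)
  obtain k where k: "order (G Mod N) = p ^ k"
    using p(2) divides_primepow_nat[OF p(1)] unfolding oQ by blast
  have "card (rcosets N) \<noteq> 1"
  proof
    assume "card (rcosets N) = 1"
    then have "card N = card (carrier G)"
      using lagrange[OF N.subgroup_axioms] by (simp add: order_def)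
    then show False
      using N(2) card_subset_eq[OF fin N.subset] by blast
  qed
  moreover have "finite (carrier (G Mod N))"
    using fin by (simp add: carrier_FactGroup)
  ultimately obtain Z where Z: "Z \<in> carrier (G Mod N)" "Z \<noteq> N"
    "\<And>Y. Y \<in> carrier (G Mod N) \<Longrightarrow> Y \<otimes>\<^bsub>G Mod N\<^esub> Z = Z \<otimes>\<^bsub>G Mod N\<^esub> Y"
    using Q.p_group_central_element[OF _ p(1) k] unfolding oQ one_FactGroup by blast
  obtain z where z: "z \<in> carrier G" "Z = N #> z"
    using Z(1) by (auto simp: carrier_FactGroup)
  have "z \<in> central_mod N"
    unfolding central_mod_iff_coset_central[OF N(1) z(1)] z(2)[symmetric] using Z(3) by simp
  moreover have "z \<notin> N"
    using Z(2) z N.rcos_const[OF is_group] by blast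
  ultimately show ?thesis by blast
qed

lemma p_group_nilpotent:
  assumes "finite (carrier G)" "Factorial_Ring.prime (p::nat)" "order G = p ^ n"
  shows "nilpotent_group G"
proof (rule nilpotent_if_central_mod_grows[OF assms(1)])
  fix N assume N: "N \<lhd> G" "N \<noteq> carrier G"
  have "card (rcosets N) dvd p ^ n"
    using lagrange[OF normal_imp_subgroup[OF N(1)]] assms(3) by (metis dvd_triv_left)
  then show "central_mod N \<noteq> N"
    by (rule p_quotient_central_mod_grows[OF assms(1) N assms(2)])
qed

text \<open>
  A normal subgroup that omits the central involution is enlarged by it. One that contains the
  involution has index a power of \<open>p\<close>, and then the quotient, being a \<open>p\<close>-group, has a non-trivial
  centre.
\<close>
lemma central_involution_nilpotent:
  assumes fin: "finite (carrier G)" and p: "Factorial_Ring.prime (p::nat)" "order G = 2 * p ^ n"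
    and z: "z \<in> carrier G" "ord z = 2" "\<And>g. g \<in> carrier G \<Longrightarrow> g \<otimes> z = z \<otimes> g"
  shows "nilpotent_group G"
proof (rule nilpotent_if_central_mod_grows[OF fin])
  fix N assume N: "N \<lhd> G" "N \<noteq> carrier G"
  interpret N: normal N G by fact
  show "central_mod N \<noteq> N"
  proof (cases "z \<in> N")
    case True
    interpret H: group "G\<lparr>carrier := N\<rparr>"
      by (rule N.subgroup_is_group[OF is_group])
    \<comment> \<open>The factor 2 of the group order is used up inside \<open>N\<close>, so the index divides \<open>p\<^sup>n\<close>.\<close>
    have "2 dvd card N"
      using H.ord_dvd_group_order[of z] True z(2) ord_in_subgroup[OF N.subgroup_axioms True]
      by (simp add: order_def)
    then obtain m where "card N = 2 * m" ..
    then have "card (rcosets N) * m = p ^ n"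
      using lagrange[OF N.subgroup_axioms] p(2) by simp
    then have "card (rcosets N) dvd p ^ n"
      by (metis dvd_triv_left)
    then show ?thesis
      by (rule p_quotient_central_mod_grows[OF fin N p(1)])
  next
    case False
    have "z \<otimes> g \<otimes> inv z \<otimes> inv g = \<one>" if g: "g \<in> carrier G" for g
    proof -
      have "z \<otimes> g \<otimes> inv z \<otimes> inv g = (z \<otimes> g) \<otimes> inv (g \<otimes> z)"
        using z(1) g by (simp add: inv_mult_group m_assoc)
      then show ?thesis
        using z g by simp
    qed
    then have "z \<in> central_mod N"
      using z(1) by (auto simp: central_mod_def)
    then show ?thesis using False by blast
  qed
qed

section \<open>Elements of coprime order in nilpotent groups\<close>
lemma conj_pow:
  assumes "x \<in> carrier G" "y \<in> carrier G"
  shows "(x \<otimes> y \<otimes> inv x) [^] (n::nat) = x \<otimes> y [^] n \<otimes> inv x"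
proof (induction n)
  case (Suc n)
  then show ?case
    using assms by (simp add: m_assoc inv_cancel_middle)
qed (use assms in simp)

text \<open>
  Raise \<open>x y x\<^sup>-\<^sup>1 = c y\<close> to the power \<open>ord y\<close>: the left side becomes a conjugate of the identity,
  and on the right \<open>c\<close> and \<open>y\<close> can be separated because they commute.
\<close>
lemma commutator_pow_ord:
  assumes x: "x \<in> carrier G" and y: "y \<in> carrier G"
    and c: "c = x \<otimes> y \<otimes> inv x \<otimes> inv y" "c \<otimes> y = y \<otimes> c"
  shows "c [^] ord y = \<one>"
proof -
  have cG: "c \<in> carrier G" using c x y by simp
  have "x \<otimes> y \<otimes> inv x = c \<otimes> y"
    using x y by (simp add: c m_assoc)
  then have "c [^] ord y \<otimes> y [^] ord y = x \<otimes> y [^] ord y \<otimes> inv x"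
    using pow_mult_distrib[OF c(2) cG y, of "ord y"] conj_pow[OF x y, of "ord y"] by simp
  then show ?thesis
    using x y cG by simp
qed

text \<open>
  The order of \<open>c\<close> divides that of \<open>y\<close>; since \<open>c\<^sup>-\<^sup>1\<close> is the commutator of \<open>y\<close> and \<open>x\<close>, it also
  divides that of \<open>x\<close>.
\<close>
lemma central_commutator_coprime:
  assumes x: "x \<in> carrier G" and y: "y \<in> carrier G" and cop: "coprime (ord x) (ord y)"
    and c: "c = x \<otimes> y \<otimes> inv x \<otimes> inv y" "c \<otimes> x = x \<otimes> c" "c \<otimes> y = y \<otimes> c"
  shows "c = \<one>"
proof -
  have cG: "c \<in> carrier G" using c x y by simp
  have inv_c: "inv c = y \<otimes> x \<otimes> inv y \<otimes> inv x"
    using x y by (simp add: c(1) inv_mult_group m_assoc)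
  have "inv c \<otimes> x = x \<otimes> inv c"
    using commute_inv[OF cG x c(2)] .
  then have "inv c [^] ord x = \<one>"
    by (rule commutator_pow_ord[OF y x inv_c])
  then have "ord c dvd ord x"
    using cG by (metis inv_closed ord_inv pow_eq_id)
  moreover have "ord c dvd ord y"
    using commutator_pow_ord[OF x y c(1,3)] cG by (simp add: pow_eq_id)
  ultimately show ?thesis
    using cop cG ord_eq_1 coprime_common_divisor_nat by blast
qed

text \<open>
  This is the previous lemma applied to the cosets of \<open>x\<close> and \<open>y\<close> in \<open>G/N\<close>, whose orders divide those
  of \<open>x\<close> and \<open>y\<close>. It pushes the commutator one step down a central series.
\<close>
lemma commutator_in_if_central_mod:
  assumes N: "N \<lhd> G" and x: "x \<in> carrier G" and y: "y \<in> carrier G"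
    and cop: "coprime (ord x) (ord y)"
    and c: "x \<otimes> y \<otimes> inv x \<otimes> inv y \<in> central_mod N"
  shows "x \<otimes> y \<otimes> inv x \<otimes> inv y \<in> N"
proof -
  interpret N: normal N G by fact
  interpret Q: group "G Mod N" by (rule N.factorgroup_is_group)
  let ?h = "\<lambda>x. N #> x"
  interpret h: group_hom G "G Mod N" ?h
    using N.r_coset_hom_Mod by unfold_locales
  let ?c = "x \<otimes> y \<otimes> inv x \<otimes> inv y"
  have ord_dvd: "Q.ord (?h g) dvd ord g" if "g \<in> carrier G" for g
    using that N.FactGroup_pow[of g "ord g"] by (simp flip: Q.pow_eq_id add: h.hom_closed)
  have "?h ?c = \<one>\<^bsub>G Mod N\<^esub>"
  proof (rule Q.central_commutator_coprime)
    show "?h x \<in> carrier (G Mod N)" "?h y \<in> carrier (G Mod N)"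
      using x y by (auto intro: h.hom_closed)
    show "coprime (Q.ord (?h x)) (Q.ord (?h y))"
      using cop ord_dvd x y by (meson coprime_divisors)
    show "?h ?c = ?h x \<otimes>\<^bsub>G Mod N\<^esub> ?h y \<otimes>\<^bsub>G Mod N\<^esub> inv\<^bsub>G Mod N\<^esub> ?h x \<otimes>\<^bsub>G Mod N\<^esub> inv\<^bsub>G Mod N\<^esub> ?h y"
      using x y by (simp del: mult_FactGroup)
    show "?h ?c \<otimes>\<^bsub>G Mod N\<^esub> ?h x = ?h x \<otimes>\<^bsub>G Mod N\<^esub> ?h ?c"
      "?h ?c \<otimes>\<^bsub>G Mod N\<^esub> ?h y = ?h y \<otimes>\<^bsub>G Mod N\<^esub> ?h ?c"
      using central_mod_iff_coset_central[OF N, of ?c] c x y h.hom_closed[OF x] h.hom_closed[OF y]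
      by blast+
  qed
  then show ?thesis
    using rcos_self[OF _ N.subgroup_axioms, of ?c] x y by simp
qed

text \<open>
  The commutator lies in every term of the lower central series, because consecutive terms
  satisfy the hypothesis of the previous lemma.
\<close>
lemma nilpotent_coprime_commute:
  assumes nil: "nilpotent_group G" and x: "x \<in> carrier G" and y: "y \<in> carrier G"
    and cop: "coprime (ord x) (ord y)"
  shows "x \<otimes> y = y \<otimes> x"
proof -
  have "x \<otimes> y \<otimes> inv x \<otimes> inv y \<in> lower_central_series G n" for n
  proof (induction n)
    case 0
    then show ?case using x y by simp
  next
    case (Suc n)
    then show ?case
      using commutator_in_if_central_mod[OF lower_central_series_normal x y cop]
        lower_central_series_subset_central_mod by blast
  qed
  then have "x \<otimes> y \<otimes> inv x \<otimes> inv y = \<one>"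
    using nil unfolding nilpotent_group_def by blast
  then have "x \<otimes> y \<otimes> inv (y \<otimes> x) = \<one>"
    using x y by (simp add: inv_mult_group m_assoc)
  then have "x \<otimes> y \<otimes> inv (y \<otimes> x) \<otimes> (y \<otimes> x) = \<one> \<otimes> (y \<otimes> x)"
    by simp
  then show ?thesis
    using x y by (simp add: m_assoc)
qed


section \<open>Involutions in groups of twice odd order\<close>
lemma ord_dvd_card_subgroup:
  assumes "subgroup H G" "x \<in> H"
  shows "ord x dvd card H"
proof -
  interpret H: group "G\<lparr>carrier := H\<rparr>"
    by (rule subgroup.subgroup_is_group[OF assms(1) is_group])
  show ?thesis
    using H.ord_dvd_group_order[of x] assms(2) ord_in_subgroup[OF assms] by (simp add: order_def)
qed

text \<open>
  \<open>P\<close> has index 2 and contains no involution, so two involutions lie in the same coset and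
  \<open>z' = w z\<close> with \<open>w \<in> P\<close>. As \<open>w\<close> has odd order, it commutes with \<open>z\<close>; squaring gives
  \<open>w\<^sup>2 = 1\<close>, so \<open>w = 1\<close>.
\<close>
lemma nilpotent_unique_involution:
  assumes fin: "finite (carrier G)" and nil: "nilpotent_group G"
    and ord_G: "order G = 2 * m" "odd m" and P: "subgroup P G" "card P = m"
    and z: "z \<in> carrier G" "ord z = 2" and z': "z' \<in> carrier G" "ord z' = 2"
  shows "z' = z"
proof -
  interpret P: subgroup P G by (rule P(1))
  have "card (rcosets P) * m = 2 * m"
    using lagrange[OF P(1)] P(2) ord_G(1) by simp
  then have card_2: "card (rcosets P) = 2"
    using ord_G(2) by auto
  then have fin_cosets: "finite (rcosets P)"
    by (intro card_ge_0_finite) simp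
  \<comment> \<open>The order of \<open>P\<close> is odd, so \<open>P\<close> contains no involution.\<close>
  have not_P: "P #> y \<noteq> P" if y: "y \<in> carrier G" "ord y = 2" for y
  proof
    assume "P #> y = P"
    then have "y \<in> P"
      using rcos_self[OF y(1) P(1)] by simp
    then show False
      using ord_dvd_card_subgroup[OF P(1), of y] y(2) P(2) ord_G(2) by simp
  qed
  have mem: "P \<in> rcosets P" "P #> z \<in> rcosets P" "P #> z' \<in> rcosets P"
    using P.subgroup_in_rcosets[OF is_group] rcosetsI[OF P.subset] z(1) z'(1) by auto
  have "rcosets P = {P, P #> z}"
    using card_seteq[OF fin_cosets, of "{P, P #> z}"] mem not_P[OF z, symmetric] card_2
    by simp
  then have "P #> z' = P #> z"
    using mem(3) not_P[OF z'] by blast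
  then have "z' \<in> P #> z"
    using rcos_self[OF z'(1) P(1)] by simp
  then have w: "z' \<otimes> inv z \<in> P"
    by (rule P.rcos_module_imp[OF is_group z(1)])
  define w where "w = z' \<otimes> inv z"
  have wG: "w \<in> carrier G" and z'_eq: "z' = w \<otimes> z"
    using z(1) z'(1) by (simp_all add: w_def m_assoc)
  have ord_w: "odd (ord w)"
    using ord_dvd_card_subgroup[OF P(1) w] P(2) ord_G(2) dvd_trans[of 2 "ord w" m]
    unfolding w_def by blast
  then have "w \<otimes> z = z \<otimes> w"
    using z(2) by (intro nilpotent_coprime_commute[OF nil wG z(1)]) (simp add: coprime_right_2_iff_odd)
  then have "z' [^] (2::nat) = w [^] (2::nat) \<otimes> z [^] (2::nat)"
    unfolding z'_eq by (rule pow_mult_distrib[OF _ wG z(1)])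
  moreover have "z [^] (2::nat) = \<one>" "z' [^] (2::nat) = \<one>"
    using pow_ord_eq_1[OF z(1)] pow_ord_eq_1[OF z'(1)] z(2) z'(2) by simp_all
  ultimately have "w [^] (2::nat) = \<one>"
    using wG by simp
  then have "ord w dvd 2"
    using wG by (simp add: pow_eq_id)
  then have "ord w = 1"
    using ord_w two_is_prime_nat unfolding prime_nat_iff by auto
  then show ?thesis
    using wG z(1) ord_eq_1[OF wG] z'_eq by simp
qed

text \<open>
  Every conjugate of \<open>z\<close> is an involution, hence equal to \<open>z\<close>.
\<close>
lemma unique_involution_central:
  assumes z: "z \<in> carrier G" "ord z = 2"
    and unique: "\<And>y. y \<in> carrier G \<Longrightarrow> ord y = 2 \<Longrightarrow> y = z"
    and g: "g \<in> carrier G"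
  shows "g \<otimes> z = z \<otimes> g"
proof -
  have "ord (g \<otimes> z \<otimes> inv g) = 2"
  proof -
    have "(g \<otimes> z \<otimes> inv g) [^] n = \<one> \<longleftrightarrow> z [^] n = \<one>" for n :: nat
    proof -
      have "g \<otimes> z [^] n \<otimes> inv g = \<one> \<longleftrightarrow> g \<otimes> z [^] n = \<one> \<otimes> g"
        using g z(1) inv_solve_right'[of \<one> "g \<otimes> z [^] n" g] by auto
      then show ?thesis
        using g z(1) by (simp add: conj_pow)
    qed
    then show ?thesis
      using g z by (simp add: ord_unique pow_eq_id)
  qed
  then have "g \<otimes> z \<otimes> inv g = z"
    using unique g z(1) by simp
  then show ?thesis
    using g z(1) inv_solve_right'[of z "g \<otimes> z" g] by simp
qed

section \<open>Elements of prime power order\<close>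

text \<open>
  The exponent \<open>a\<close> may be smaller than the multiplicity of \<open>p\<close> in the group order; this allows
  a subgroup of order 4 to be used when only divisibility by 4 is known.
\<close>
lemma sylow_subgroup:
  assumes "finite (carrier G)" "Factorial_Ring.prime (p::nat)" "p ^ a dvd order G"
  obtains H where "subgroup H G" "card H = p ^ a"
  using sylow_thm[OF assms(2) is_group _ assms(1)] assms(3) unfolding dvd_def by blast

lemma two_elements_of_p_power_order:
  assumes fin: "finite (carrier G)" and p: "Factorial_Ring.prime (p::nat)" "p ^ a dvd order G" "3 \<le> p ^ a"
  obtains x y where "x \<in> carrier G" "y \<in> carrier G" "x \<noteq> y"
    "ord x dvd p ^ a" "ord y dvd p ^ a" "\<not> coprime (ord x) (ord y)"
proof -
  obtain H where H: "subgroup H G" "card H = p ^ a"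
    using sylow_subgroup[OF fin p(1,2)] .
  have "2 \<le> card (H - {\<one>})"
    using H p(3) by (simp add: card_Diff_subset subgroup.one_closed)
  then obtain x y where xy: "x \<in> H" "y \<in> H" "x \<noteq> \<one>" "y \<noteq> \<one>" "x \<noteq> y"
  proof -
    obtain T where "T \<subseteq> H - {\<one>}" "card T = 2"
      using \<open>2 \<le> card (H - {\<one>})\<close> obtain_subset_with_card_n by metis
    then show thesis
      using that unfolding card_2_iff by auto
  qed
  have p_dvd: "p dvd ord u" if "u \<in> H" "u \<noteq> \<one>" for u
  proof -
    have "ord u dvd p ^ a"
      using ord_dvd_card_subgroup[OF H(1) that(1)] H(2) by simp
    then obtain i where i: "ord u = p ^ i"
      using divides_primepow_nat[OF p(1)] by blast
    have "ord u \<noteq> 1"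
      using that ord_eq_1 subgroup.mem_carrier[OF H(1)] by blast
    then have "i \<noteq> 0"
      using i by auto
    then show ?thesis
      using i by (simp add: dvd_power)
  qed
  show thesis
  proof (rule that[of x y])
    show "x \<in> carrier G" "y \<in> carrier G"
      using xy subgroup.mem_carrier[OF H(1)] by blast+
    show "ord x dvd p ^ a" "ord y dvd p ^ a"
      using xy ord_dvd_card_subgroup[OF H(1)] H(2) by auto
    show "\<not> coprime (ord x) (ord y)"
    proof
      assume "coprime (ord x) (ord y)"
      then have "p dvd 1"
        using coprime_common_divisor[of "ord x" "ord y" p] p_dvd[OF xy(1,3)] p_dvd[OF xy(2,4)] by simp
      then show False
        using p(1) by simp
    qed
  qed fact
qed

lemma involution_exists:
  assumes "finite (carrier G)" "even (order G)"
  obtains z where "z \<in> carrier G" "ord z = 2"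
proof -
  obtain H where H: "subgroup H G" "card H = 2"
    using sylow_subgroup[OF assms(1) two_is_prime_nat, of 1] assms(2) by auto
  then obtain z where z: "z \<in> H" "z \<noteq> \<one>"
    using subgroup.one_closed[OF H(1)] unfolding card_2_iff by auto
  have zG: "z \<in> carrier G"
    using subgroup.mem_carrier[OF H(1) z(1)] .
  have "ord z dvd 2"
    using ord_dvd_card_subgroup[OF H(1) z(1)] H(2) by simp
  moreover have "ord z \<noteq> 1"
    using ord_eq_1[OF zG] z(2) by blast
  ultimately have "ord z = 2"
    using two_is_prime_nat unfolding prime_nat_iff by blast
  then show thesis
    using that zG by blast
qed

section \<open>Split coprime graphs\<close>
lemma coprime_graph_adjacent:
  assumes "x \<in> carrier G" "y \<in> carrier G" "x \<noteq> y"
  shows "{x, y} \<in> snd (coprime_graph G) \<longleftrightarrow> coprime (ord x) (ord y)"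
  using assms by (simp add: coprime_graph_adjacent_iff coprime_iff_gcd_eq_1)

text \<open>
  Each of the two non-adjacent pairs must meet the independent part \<open>I\<close>. If \<open>m\<close> and \<open>n\<close> were
  coprime, the two elements of \<open>I\<close> found in this way would be adjacent.
\<close>
lemma coprime_graph_not_split:
  assumes split: "split_graph (coprime_graph G)"
    and x: "x1 \<in> carrier G" "x2 \<in> carrier G" "x1 \<noteq> x2" "\<not> coprime (ord x1) (ord x2)"
      "ord x1 dvd m" "ord x2 dvd m"
    and y: "y1 \<in> carrier G" "y2 \<in> carrier G" "y1 \<noteq> y2" "\<not> coprime (ord y1) (ord y2)"
      "ord y1 dvd n" "ord y2 dvd n"
  shows "\<not> coprime m n"
proof
  assume cop: "coprime m n"
  obtain I K where part: "I \<union> K = carrier G"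
    and I: "indep I (snd (coprime_graph G))" and K: "clique K (snd (coprime_graph G))"
    using split unfolding split_graph_def by (auto simp: coprime_graph_def)
  have in_I: "\<exists>u\<in>{a, b}. u \<in> I"
    if ab: "a \<in> carrier G" "b \<in> carrier G" "a \<noteq> b" "\<not> coprime (ord a) (ord b)" for a b
  proof -
    have "\<not> (a \<in> K \<and> b \<in> K)"
      using ab(3,4) K coprime_graph_adjacent[OF ab(1-3)] unfolding clique_def by auto
    then show ?thesis
      using ab(1,2) part by auto
  qed
  obtain u where u: "u \<in> I" "u \<in> carrier G" "ord u dvd m" "ord u \<noteq> 1"
  proof -
    have "ord x1 \<noteq> 1" "ord x2 \<noteq> 1"
      using x(4) by auto
    then show thesis
      using in_I[OF x(1-4)] x(1,2,5,6) that by auto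
  qed
  obtain v where v: "v \<in> I" "v \<in> carrier G" "ord v dvd n" 
    using in_I[OF y(1-4)] y(1,2,5,6) by auto
  have uv: "coprime (ord u) (ord v)"
    using coprime_divisors[OF u(3) v(3) cop] .
  then have "u \<noteq> v"
    using u(4) by auto
  then show False
    using I u(1) v(1) uv coprime_graph_adjacent[OF u(2) v(2)] unfolding indep_def by simp
qed

text \<open>
  Two elements whose orders share the prime factor \<open>p\<close> are never adjacent, so the complement of
  \<open>K\<close> is independent.
\<close>
lemma coprime_graph_splitI:
  assumes K: "K \<subseteq> carrier G" "\<And>x y. x \<in> K \<Longrightarrow> y \<in> K \<Longrightarrow> x \<noteq> y \<Longrightarrow> coprime (ord x) (ord y)"
    and p: "Factorial_Ring.prime (p::nat)" "\<And>x. x \<in> carrier G - K \<Longrightarrow> p dvd ord x"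
  shows "split_graph (coprime_graph G)"
  unfolding split_graph_def
proof (intro exI conjI)
  show "(carrier G - K) \<union> K = fst (coprime_graph G)"
    using K(1) by (auto simp: coprime_graph_def)
  show "(carrier G - K) \<inter> K = {}"
    by blast
  have "\<not> coprime (ord x) (ord y)" if "x \<in> carrier G - K" "y \<in> carrier G - K" for x y
  proof
    assume "coprime (ord x) (ord y)"
    then have "p dvd 1"
      using coprime_common_divisor[of "ord x" "ord y" p] p(2)[OF that(1)] p(2)[OF that(2)] by simp
    then show False
      using p(1) by simp
  qed
  then show "indep (carrier G - K) (snd (coprime_graph G))"
    unfolding indep_def by (simp add: coprime_graph_adjacent)
  show "clique K (snd (coprime_graph G))"
    unfolding clique_def using K by (simp add: coprime_graph_adjacent subset_iff)
qed

end

section \<open>Numbers that are neither a prime power nor twice one\<close>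
lemma power_of_2_or_odd_prime_divisor:
  fixes N :: nat
  assumes "N > 0"
  shows "(\<exists>n. N = 2 ^ n) \<or> (\<exists>p. Factorial_Ring.prime p \<and> p \<noteq> 2 \<and> p dvd N)"
proof -
  obtain k u where u: "N = 2 ^ k * u" "odd u"
    using multiplicity_decompose'[of N 2] assms by (metis neq0_conv odd_one)
  show ?thesis
  proof (cases "u = 1")
    case True
    then show ?thesis using u(1) by auto
  next
    case False
    then obtain p where "Factorial_Ring.prime p" "p dvd u"
      using prime_factor_nat by blast
    then show ?thesis
      using u dvd_mult[of p u "2 ^ k"] by blast
  qed
qed

text \<open>
  The bound 3 excludes exactly the factor 2, the order of the only non-trivial group of prime power
  order with fewer than two non-identity elements. Once the full power of an odd prime has been
  removed, the remaining cofactor \<open>m > 2\<close> has an odd prime divisor or is divisible by 4.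
\<close>
lemma two_large_prime_powers_dvd:
  fixes N :: nat
  assumes N: "N > 0"
    and not_pp: "\<And>p n. Factorial_Ring.prime (p::nat) \<Longrightarrow> N \<noteq> p ^ n \<and> N \<noteq> 2 * p ^ n"
  obtains p a q b where "Factorial_Ring.prime (p::nat)" "Factorial_Ring.prime (q::nat)" "p \<noteq> q"
    "p ^ a dvd N" "q ^ b dvd N" "3 \<le> p ^ a" "3 \<le> q ^ b"
proof -
  obtain p where p: "Factorial_Ring.prime p" "p \<noteq> 2" "p dvd N"
    using power_of_2_or_odd_prime_divisor[OF N] not_pp[OF two_is_prime_nat] by blast
  obtain k m where m: "N = p ^ k * m" "\<not> p dvd m"
    using multiplicity_decompose'[of N p] N not_prime_unit p(1) by (metis neq0_conv)
  have ge3: "3 \<le> q" if "Factorial_Ring.prime q" "q \<noteq> 2" for q :: nat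
    using prime_ge_2_nat[OF that(1)] that(2) by linarith
  have "m \<noteq> 1" "m \<noteq> 2" "m > 0"
    using m(1) not_pp[OF p(1), of k] N by (auto simp: mult.commute)
  have "\<exists>q b. Factorial_Ring.prime q \<and> q \<noteq> p \<and> q ^ b dvd m \<and> 3 \<le> q ^ b"
  proof (cases "\<exists>k. m = 2 ^ k")
    case True
    then obtain k where k: "m = 2 ^ k" ..
    then have "2 \<le> k"
      using \<open>m \<noteq> 1\<close> \<open>m \<noteq> 2\<close> by (cases "k = 0"; cases "k = 1") auto
    then have "(2::nat) ^ 2 dvd m"
      unfolding k by (rule le_imp_power_dvd)
    then show ?thesis
      using p(2) two_is_prime_nat by (intro exI[of _ 2]) auto
  next
    case False
    then obtain q where q: "Factorial_Ring.prime q" "q \<noteq> 2" "q dvd m"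
      using power_of_2_or_odd_prime_divisor[OF \<open>m > 0\<close>] by blast
    then have "q \<noteq> p"
      using m(2) by blast
    then show ?thesis
      using q ge3[OF q(1,2)] by (intro exI[of _ q] exI[of _ 1]) auto
  qed
  then obtain q b where q: "Factorial_Ring.prime q" "q \<noteq> p" "q ^ b dvd m" "3 \<le> q ^ b"
    by blast
  show thesis
  proof (rule that[of p q 1 b])
    show "q ^ b dvd N"
      unfolding m(1) by (rule dvd_mult[OF q(3)])
  qed (use p q ge3[OF p(1,2)] in auto)
qed

context group
begin

section \<open>The characterisation\<close>
lemma split_coprime_graph_imp:
  assumes fin: "finite (carrier G)" and split: "split_graph (coprime_graph G)"
  shows "nilpotent_group G \<and>
    (\<exists>(p::nat) n. Factorial_Ring.prime p \<and> (order G = p ^ n \<or> order G = 2 * p ^ n))"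
proof -
  have "\<exists>(p::nat) n. Factorial_Ring.prime p \<and> (order G = p ^ n \<or> order G = 2 * p ^ n)"
  proof (rule ccontr)
    assume "\<not> ?thesis"
    then have not_pp: "\<And>p n. Factorial_Ring.prime (p::nat) \<Longrightarrow> order G \<noteq> p ^ n \<and> order G \<noteq> 2 * p ^ n"
      by blast
    have "order G > 0"
      using fin order_gt_0_iff_finite by blast
    then obtain p a q b where pq: "Factorial_Ring.prime (p::nat)" "Factorial_Ring.prime (q::nat)" "p \<noteq> q"
        "p ^ a dvd order G" "q ^ b dvd order G" "3 \<le> p ^ a" "3 \<le> q ^ b"
      by (rule two_large_prime_powers_dvd[OF _ not_pp])
    obtain x1 x2 where x: "x1 \<in> carrier G" "x2 \<in> carrier G" "x1 \<noteq> x2"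
      "ord x1 dvd p ^ a" "ord x2 dvd p ^ a" "\<not> coprime (ord x1) (ord x2)"
      by (rule two_elements_of_p_power_order[OF fin pq(1,4,6)])
    obtain y1 y2 where y: "y1 \<in> carrier G" "y2 \<in> carrier G" "y1 \<noteq> y2"
      "ord y1 dvd q ^ b" "ord y2 dvd q ^ b" "\<not> coprime (ord y1) (ord y2)"
      by (rule two_elements_of_p_power_order[OF fin pq(2,5,7)])
    have "coprime (p ^ a) (q ^ b)"
      using primes_coprime[OF pq(1-3)] by simp
    then show False
      using coprime_graph_not_split[OF split x(1-3,6,4,5) y(1-3,6,4,5)] by contradiction
  qed
  then obtain p n where p: "Factorial_Ring.prime (p::nat)" "order G = p ^ n \<or> order G = 2 * p ^ n"
    by blast
  have "nilpotent_group G"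
  \<comment> \<open>The second disjunct catches the orders \<open>2p\<^sup>n\<close> with \<open>p = 2\<close> or \<open>n = 0\<close>.\<close>
  proof (cases "(\<exists>k. order G = p ^ k) \<or> (\<exists>k. order G = 2 ^ k)")
    case True
    then show ?thesis
      by (elim disjE exE) (rule p_group_nilpotent[OF fin p(1)], assumption,
          rule p_group_nilpotent[OF fin two_is_prime_nat], assumption)
  next
    case False
    then have ord_G: "order G = 2 * p ^ n"
      using p(2) by blast
    have "p \<noteq> 2"
    proof
      assume "p = 2"
      then have "order G = 2 ^ Suc n"
        using ord_G by simp
      then show False
        using False by blast
    qed
    have "n \<noteq> 0"
    proof
      assume "n = 0"
      then have "order G = 2 ^ 1"
        using ord_G by simp
      then show False
        using False by blast
    qed
    have "3 \<le> p"
      using prime_ge_2_nat[OF p(1)] \<open>p \<noteq> 2\<close> by linarith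
    also have "p \<le> p ^ n"
      using \<open>n \<noteq> 0\<close> \<open>3 \<le> p\<close> by (simp add: self_le_power)
    finally have "3 \<le> p ^ n" .
    have odd: "coprime 2 (p ^ n)"
      using primes_coprime[OF two_is_prime_nat p(1)] \<open>p \<noteq> 2\<close> by simp
    obtain x1 x2 where x: "x1 \<in> carrier G" "x2 \<in> carrier G" "x1 \<noteq> x2"
      "ord x1 dvd p ^ n" "ord x2 dvd p ^ n" "\<not> coprime (ord x1) (ord x2)"
      by (rule two_elements_of_p_power_order[OF fin p(1) _ \<open>3 \<le> p ^ n\<close>]) (simp add: ord_G)
    obtain z where z: "z \<in> carrier G" "ord z = 2"
      using involution_exists[OF fin] ord_G by auto
    \<comment> \<open>A second involution would close a 4-cycle \<open>y, x1, z, x2\<close>.\<close>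
    have unique: "y = z" if y: "y \<in> carrier G" "ord y = 2" for y
    proof (rule ccontr)
      assume "y \<noteq> z"
      moreover have "\<not> coprime (ord y) (ord z)" "ord y dvd 2" "ord z dvd 2"
        using y z by simp_all
      ultimately show False
        using coprime_graph_not_split[OF split y(1) z(1) _ _ _ _ x(1-3,6,4,5)] odd by blast
    qed
    show ?thesis
      by (rule central_involution_nilpotent[OF fin p(1) ord_G z unique_involution_central[OF z unique]])
  qed
  then show ?thesis
    using p by blast
qed

lemma split_coprime_graph_if:
  assumes fin: "finite (carrier G)" and nil: "nilpotent_group G"
    and p: "Factorial_Ring.prime (p::nat)" "order G = p ^ n \<or> order G = 2 * p ^ n"
  shows "split_graph (coprime_graph G)"
proof -
  \<comment> \<open>An order prime to \<open>p\<close> divides the cofactor of any power of \<open>p\<close> in the group order.\<close>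
  have dvd_cofactor: "ord x dvd m" if "x \<in> carrier G" "order G = m * p ^ k" "\<not> p dvd ord x" for x m k
  proof -
    have "coprime (ord x) (p ^ k)"
      using prime_imp_coprime[OF p(1) that(3)] by (simp add: coprime_commute)
    then show ?thesis
      using ord_dvd_group_order[OF that(1)] that(2) by (simp add: coprime_dvd_mult_left_iff)
  qed
  show ?thesis
  proof (cases "\<exists>k. order G = p ^ k")
    case True
    then obtain k where k: "order G = 1 * p ^ k" by auto
    show ?thesis
    proof (rule coprime_graph_splitI[of "{\<one>}", OF _ _ p(1)])
      show "p dvd ord x" if "x \<in> carrier G - {\<one>}" for x
        using dvd_cofactor[OF _ k, of x] that ord_eq_1 by auto
    qed auto
  next
    case False
    then have ord_G: "order G = 2 * p ^ n"
      using p(2) by blast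
    have "p \<noteq> 2"
    proof
      assume "p = 2"
      then have "order G = p ^ Suc n"
        using ord_G by simp
      then show False
        using False by blast
    qed
    then have odd: "odd (p ^ n)"
      using primes_dvd_imp_eq[OF two_is_prime_nat p(1)] by (auto simp: prime_dvd_power_iff)
    obtain P where P: "subgroup P G" "card P = p ^ n"
      using sylow_subgroup[OF fin p(1), of n] ord_G by auto
    obtain z where z: "z \<in> carrier G" "ord z = 2"
      using involution_exists[OF fin] ord_G by auto
    show ?thesis
    proof (rule coprime_graph_splitI[of "{\<one>, z}", OF _ _ p(1)])
      show "p dvd ord x" if x: "x \<in> carrier G - {\<one>, z}" for x
      proof (rule ccontr)
        assume "\<not> p dvd ord x"
        then have "ord x dvd 2"
          using dvd_cofactor[OF _ ord_G, of x] x by blast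
        then have "ord x = 1 \<or> ord x = 2"
          using two_is_prime_nat unfolding prime_nat_iff by blast
        then show False
          using x ord_eq_1[of x] nilpotent_unique_involution[OF fin nil ord_G odd P z, of x] by blast
      qed
      show "coprime (ord x) (ord y)" if "x \<in> {\<one>, z}" "y \<in> {\<one>, z}" "x \<noteq> y" for x y
        using that by auto
    qed (use z in auto)
  qed
qed

end

theorem theorem8:
  fixes G :: "('a, 'b) monoid_scheme"
  assumes "group G" and "finite (carrier G)"
  shows "split_graph (coprime_graph G) \<longleftrightarrow>
    nilpotent_group G \<and>
    (\<exists>(p::nat) n. Factorial_Ring.prime p \<and> (order G = p ^ n \<or> order G = 2 * p ^ n))"
  using group.split_coprime_graph_imp[OF assms] group.split_coprime_graph_if[OF assms] by blast

end
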